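(* Let $D$ be a knot projection and let $\#\mathcal{M}(D)$ denote the number of discrete Morse functions on $\Xi(D)$. Let $E(G_b)=\{e_1,\dots,e_m\}$ and let $e_i^*$ be the edge of $G_b^*=G_w$ dual to $e_i$. Then $\#\mathcal{M}(D)$ can be computed by considering the product $$p_{G_b^*}^{symb}(-1,E(G_b))\cdot p_{G_b}^{symb}(-1,E(G_b^* ))\in \mathbb{Z}[E(G_b),E(G_b^* )]\big/\langle e_i\cdot e_i^*\rangle_{i=1,\dots,|E(G_b)|}$$ and evaluating all variables $e_i$ and $e_i^*$, $i=1,\dots,m$, at $1$ in a minimal representative of this class.
   Context: Setting. $D$ is the projection of a knot diagram with at least one crossing, viewed as a connected 4-valent graph on $S^2$, with a chequerboard black/white colouring of the regions. The black graph $G_b$ has the black regions as vertices and one edge for each crossing, joining the two black regions opposite each other at that crossing; the white graph $G_w$ is defined analogously and is the plane dual $G_b^*$ of $G_b$. The overlaid Tait graph $\Gamma(D)$ is the superimposition of $G_b$ and $G_w$ on $S^2$: its vertices are the black regions, the white regions and the crossings, and its edges are the half-edges of $G_b$ and $G_w$, each joining a region to an incident crossing. $\Xi(D)$ is the cell structure on $S^2$ whose 2-cells are given by the vertices of $G_w$, 1-cells by the crossings, and 0-cells by the vertices of $G_b$. Its poset graph is $\Gamma(D)$, with edges oriented from white vertices to crossings and from crossings to black vertices. A discrete Morse function on $\Xi(D)$ means an equivalence class of such functions, i.e. a (possibly empty) matching on $\Gamma(D)$ that is acyclic: reversing the orientation of all matched edges yields a directed graph without directed cycles. For a graph $G$ with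 edges regarded as commuting formal variables, the symbolic Laplacian $L^{symb}(G)$ is the matrix indexed by vertices whose $(i,i)$ entry is the formal sum of the non-loop edges incident to $v_i$ and whose $(i,j)$ entry, $i\neq j$, is minus the formal sum of all edges connecting $v_i$ to $v_j$. Set $p_G^{symb}(t,\cdot)=\det(L^{symb}(G)-t\cdot \mathrm{Id})$. In the product, $p^{symb}_{G_b^*}$ is written in one set of $m$ variables $e_1,\dots,e_m$ and $p^{symb}_{G_b}$ in the other set $e_1^*,\dots,e_m^*$, where in each case the variable with index $i$ stands for the edge passing through the $i$-th crossing. A minimal representative is the one obtained by discarding every monomial divisible by some $e_i e_i^*$. *)

theory Defs
  imports
    "HOL-Combinatorics.Orbits"
    "HOL-Library.Poly_Mapping"
    "HOL-Algebra.QuotRing"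
    "Jordan_Normal_Form.Determinant"
    "Graph_Theory.Arc_Walk"
begin

section \<open>Knot projections on the sphere\<close>

text \<open>
  A 4-valent graph on the oriented sphere is given by its combinatorial map: the darts are the
  ends of the strands at the crossings, \<open>rot\<close> takes a dart to the next one counterclockwise around
  the same crossing, and \<open>flip\<close> takes a dart to the other end of the same strand.
  Crossings and strands are the orbits of \<open>rot\<close> and \<open>flip\<close>. The dart following \<open>d\<close> on the boundary
  of the region to the left of \<open>d\<close> is the one that precedes \<open>flip d\<close> in the counterclockwise order,
  so that the regions are the orbits of the inverse of \<open>rot\<close> after \<open>flip\<close>. The chequerboard colouring is recorded by
  the set of black regions.
\<close>

record 'd projection =
  darts :: "'d set"
  rot :: "'d \<Rightarrow> 'd"
  flip :: "'d \<Rightarrow> 'd"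
  blacks :: "'d set set"

definition crossing :: "'d projection \<Rightarrow> 'd \<Rightarrow> 'd set" where
  "crossing D d = orbit (rot D) d"

definition region :: "'d projection \<Rightarrow> 'd \<Rightarrow> 'd set" where
  "region D d = orbit (inv_into UNIV (rot D) \<circ> flip D) d"

definition strand :: "'d projection \<Rightarrow> 'd \<Rightarrow> 'd set" where
  "strand D d = orbit (flip D) d"

definition crossings :: "'d projection \<Rightarrow> 'd set set" where
  "crossings D = crossing D ` darts D"

definition regions :: "'d projection \<Rightarrow> 'd set set" where
  "regions D = region D ` darts D"

definition strands :: "'d projection \<Rightarrow> 'd set set" where
  "strands D = strand D ` darts D"

definition whites :: "'d projection \<Rightarrow> 'd set set" where
  "whites D = regions D - blacks D"

definition four_valent_map :: "'d projection \<Rightarrow> bool" where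
  "four_valent_map D \<longleftrightarrow>
     finite (darts D) \<and> rot D permutes darts D \<and> flip D permutes darts D \<and>
     (\<forall>d\<in>darts D. card (crossing D d) = 4) \<and>
     (\<forall>d\<in>darts D. flip D d \<noteq> d \<and> flip D (flip D d) = d)"

text \<open>Both maps are permutations of a finite set, so directed reachability is connectedness.\<close>

definition connected_map :: "'d projection \<Rightarrow> bool" where
  "connected_map D \<longleftrightarrow>
     (\<forall>d\<in>darts D. \<forall>d'\<in>darts D. (\<lambda>x y. y = rot D x \<or> y = flip D x)\<^sup>*\<^sup>* d d')"

text \<open>A connected map lies on the sphere iff its Euler characteristic is 2.\<close>

definition spherical :: "'d projection \<Rightarrow> bool" where
  "spherical D \<longleftrightarrow> card (crossings D) + card (regions D) = card (strands D) + 2"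

text \<open>
  Travelling along the strand at \<open>d\<close> and straight ahead through the crossing at its other end, one
  leaves by the dart opposite to \<open>flip D d\<close>. The projection is that of a knot, not of a link with
  several components, iff from any dart this traverses the whole graph, each strand in one of its
  two directions.
\<close>

definition straight_ahead :: "'d projection \<Rightarrow> 'd \<Rightarrow> 'd" where
  "straight_ahead D d = rot D (rot D (flip D d))"

definition one_component :: "'d projection \<Rightarrow> bool" where
  "one_component D \<longleftrightarrow>
     (\<forall>d\<in>darts D. darts D \<subseteq> orbit (straight_ahead D) d \<union> orbit (straight_ahead D) (flip D d))"

text \<open>\<open>d\<close> and \<open>flip D d\<close> have the two sides of their common strand to their left.\<close>

definition chequerboard :: "'d projection \<Rightarrow> bool" where
  "chequerboard D \<longleftrightarrow> blacks D \<subseteq> regions D \<and>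
     (\<forall>d\<in>darts D. region D d \<in> blacks D \<longleftrightarrow> region D (flip D d) \<notin> blacks D)"

definition knot_projection :: "'d projection \<Rightarrow> bool" where
  "knot_projection D \<longleftrightarrow> darts D \<noteq> {} \<and> four_valent_map D \<and> connected_map D \<and>
     spherical D \<and> one_component D \<and> chequerboard D"


section \<open>Black graph, white graph and overlaid Tait graph\<close>

record ('v, 'e) multigraph =
  vertices :: "'v set"
  edges :: "'e set"
  ends :: "'e \<Rightarrow> 'v set"

text \<open>
  An edge with a single end is a loop. The four corners at a crossing correspond to its four darts,
  the corner of \<open>d\<close> lying between \<open>d\<close> and \<open>rot D d\<close>, in the region to the left of \<open>d\<close>. Edges of both
  graphs are named by the crossing they pass through, so the edge of \<open>white_graph D\<close> dual to an edge
  of \<open>black_graph D\<close> is the one of the same name.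
\<close>

definition black_graph :: "'d projection \<Rightarrow> ('d set, 'd set) multigraph" where
  "black_graph D = \<lparr>vertices = blacks D, edges = crossings D,
     ends = (\<lambda>c. region D ` c \<inter> blacks D)\<rparr>"

definition white_graph :: "'d projection \<Rightarrow> ('d set, 'd set) multigraph" where
  "white_graph D = \<lparr>vertices = whites D, edges = crossings D,
     ends = (\<lambda>c. region D ` c \<inter> whites D)\<rparr>"

datatype 'd cell = Region "'d set" | Crossing "'d set"

text \<open>
  The poset graph of the cell structure. The half-edges of the two graphs are the corners, that is
  the darts; a region that meets a crossing in two corners is joined to it by two edges.
\<close>

definition tait_graph :: "'d projection \<Rightarrow> ('d cell, 'd) pre_digraph" where
  "tait_graph D = \<lparr>verts = Region ` regions D \<union> Crossing ` crossings D, arcs = darts D,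
     tail = (\<lambda>d. if region D d \<in> blacks D then Crossing (crossing D d) else Region (region D d)),
     head = (\<lambda>d. if region D d \<in> blacks D then Region (region D d) else Crossing (crossing D d))\<rparr>"


section \<open>Discrete Morse functions as acyclic matchings\<close>

definition matching :: "('v, 'a) pre_digraph \<Rightarrow> 'a set \<Rightarrow> bool" where
  "matching G M \<longleftrightarrow> M \<subseteq> arcs G \<and>
     (\<forall>a\<in>M. \<forall>b\<in>M. a \<noteq> b \<longrightarrow> {tail G a, head G a} \<inter> {tail G b, head G b} = {})"

definition reverse_arcs :: "'a set \<Rightarrow> ('v, 'a) pre_digraph \<Rightarrow> ('v, 'a) pre_digraph" where
  "reverse_arcs M G = \<lparr>verts = verts G, arcs = arcs G,
     tail = (\<lambda>a. if a \<in> M then head G a else tail G a),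
     head = (\<lambda>a. if a \<in> M then tail G a else head G a)\<rparr>"

definition acyclic_matching :: "('v, 'a) pre_digraph \<Rightarrow> 'a set \<Rightarrow> bool" where
  "acyclic_matching G M \<longleftrightarrow> matching G M \<and> (\<nexists>p. pre_digraph.cycle (reverse_arcs M G) p)"

definition discrete_morse_functions :: "'d projection \<Rightarrow> 'd set set" where
  "discrete_morse_functions D = {M. acyclic_matching (tait_graph D) M}"


section \<open>Symbolic Laplacians\<close>

text \<open>
  \<open>x e\<close> is the variable of the edge \<open>e\<close>, and \<open>vs\<close> enumerates the vertices.
\<close>

definition symb_laplacian ::
    "('v, 'e) multigraph \<Rightarrow> ('e \<Rightarrow> 'r::comm_ring_1) \<Rightarrow> 'v list \<Rightarrow> 'r mat" where
  "symb_laplacian G x vs = mat (length vs) (length vs) (\<lambda>(i, j).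
     if i = j then (\<Sum>e | e \<in> edges G \<and> vs ! i \<in> ends G e \<and> ends G e \<noteq> {vs ! i}. x e)
     else - (\<Sum>e | e \<in> edges G \<and> ends G e = {vs ! i, vs ! j}. x e))"

definition p_symb ::
    "('v, 'e) multigraph \<Rightarrow> ('e \<Rightarrow> 'r::comm_ring_1) \<Rightarrow> 'v list \<Rightarrow> 'r \<Rightarrow> 'r" where
  "p_symb G x vs t = det (symb_laplacian G x vs - t \<cdot>\<^sub>m 1\<^sub>m (length vs))"


section \<open>The polynomial ring and its quotient\<close>

text \<open>Integer polynomials with variables in \<open>'x\<close>, as finitely supported maps on monomials.\<close>

type_synonym 'x int_mpoly = "('x \<Rightarrow>\<^sub>0 nat) \<Rightarrow>\<^sub>0 int"

definition var :: "'x \<Rightarrow> 'x int_mpoly" where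
  "var x = Poly_Mapping.single (Poly_Mapping.single x 1) 1"

definition eval_mpoly :: "('x \<Rightarrow> int) \<Rightarrow> 'x int_mpoly \<Rightarrow> int" where
  "eval_mpoly \<rho> p =
     (\<Sum>m\<in>Poly_Mapping.keys p. Poly_Mapping.lookup p m *
        (\<Prod>x\<in>Poly_Mapping.keys m. \<rho> x ^ Poly_Mapping.lookup m x))"

definition mpoly_ring :: "'x set \<Rightarrow> 'x int_mpoly ring" where
  "mpoly_ring V = \<lparr>carrier = {p. \<forall>m\<in>Poly_Mapping.keys p. Poly_Mapping.keys m \<subseteq> V},
     mult = (*), one = 1, zero = 0, add = (+)\<rparr>"

text \<open>\<open>Edge c\<close> is the variable \<open>e\<^sub>i\<close> and \<open>Dual_Edge c\<close> the variable \<open>e\<^sub>i\<^sup>*\<close>, with \<open>c\<close> the \<open>i\<close>-th crossing.\<close>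

datatype 'c edge_var = Edge 'c | Dual_Edge 'c

definition edge_ring :: "'d projection \<Rightarrow> 'd set edge_var int_mpoly ring" where
  "edge_ring D = mpoly_ring (Edge ` crossings D \<union> Dual_Edge ` crossings D)"

definition dual_pair_ideal :: "'d projection \<Rightarrow> 'd set edge_var int_mpoly set" where
  "dual_pair_ideal D =
     genideal (edge_ring D) ((\<lambda>c. var (Edge c) * var (Dual_Edge c)) ` crossings D)"

definition discard_dual_pairs ::
    "'d projection \<Rightarrow> 'd set edge_var int_mpoly \<Rightarrow> 'd set edge_var int_mpoly" where
  "discard_dual_pairs D p =
     (\<Sum>m | m \<in> Poly_Mapping.keys p \<and>
           \<not> (\<exists>c\<in>crossings D. Edge c \<in> Poly_Mapping.keys m \<and> Dual_Edge c \<in> Poly_Mapping.keys m).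
        Poly_Mapping.single m (Poly_Mapping.lookup p m))"

text \<open>The variables \<open>e\<^sub>i\<close> are used for the white graph, the \<open>e\<^sub>i\<^sup>*\<close> for the black one.\<close>

definition morse_product ::
    "'d projection \<Rightarrow> 'd set list \<Rightarrow> 'd set list \<Rightarrow> 'd set edge_var int_mpoly" where
  "morse_product D ws bs =
     p_symb (white_graph D) (\<lambda>c. var (Edge c)) ws (- 1) *
     p_symb (black_graph D) (\<lambda>c. var (Dual_Edge c)) bs (- 1)"

definition morse_class ::
    "'d projection \<Rightarrow> 'd set list \<Rightarrow> 'd set list \<Rightarrow> 'd set edge_var int_mpoly set" where
  "morse_class D ws bs = dual_pair_ideal D +>\<^bsub>edge_ring D\<^esub> morse_product D ws bs"

end

theory Submission
  imports Defs
begin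

text \<open>
  Expanding the determinant of \<open>L + 1\<close> row by row, a choice of summands selects for every vertex either
  nothing or an edge to a parent, and the remaining integer determinant is \<open>1\<close> if no cycle arises
  and \<open>0\<close> otherwise. Hence each factor of the product enumerates the rooted spanning forests of its graph.

  A matching on the Tait graph assigns to some of the regions a crossing through which they point to
  the opposite region of the same colour. A directed cycle that uses reversed arcs stays between
  crossings and regions of one colour, so the matching is acyclic iff these pointers form a
  rooted forest on the white and one on the black graph; it is a matching iff no crossing is used
  in both, which is what discarding the multiples of \<open>e\<^sub>i e\<^sub>i\<^sup>*\<close> enforces.
\<close>


section \<open>Rooted spanning forests\<close>

text \<open>If \<open>r\<close> is acyclic, a permutation other than the identity always meets a
  zero entry, so only the diagonal product, which is 1, survives in the Leibniz formula. If
  \<open>r\<close> has a cycle, the indicator vector of the vertices that lead into a cycle lies in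
  the kernel.\<close>

lemma det_one_minus_functional:
  fixes r :: "('v \<times> 'v) set"
  assumes "distinct vs" and "single_valued r" and r_vs: "r \<subseteq> set vs \<times> set vs"
  defines "A \<equiv> mat (length vs) (length vs) (\<lambda>(i, j).
             (if i = j then 1 else 0) - (if (vs ! i, vs ! j) \<in> r then 1 else 0)) :: int mat"
  shows "det A = (if acyclic r then 1 else 0)"
proof -
  let ?n = "length vs"
  have A: "A \<in> carrier_mat ?n ?n" by (simp add: A_def)
  show ?thesis
  proof (cases "acyclic r")
    case True
    have "finite r" using r_vs by (rule finite_subset) simp
    then have wf: "wf (r\<inverse>)" using True by (rule finite_acyclic_wf_converse)
    have vanish: "(\<Prod>i = 0..<?n. A $$ (i, p i)) = 0" if p: "p permutes {0..<?n}" and "p \<noteq> id" for p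
    proof -
      from \<open>p \<noteq> id\<close> obtain i where "p i \<noteq> i" by fastforce
      then have "i < ?n" using p by (metis atLeastLessThan_iff permutes_not_in zero_le)
      have "vs ! i \<in> (!) vs ` {i. i < ?n \<and> p i \<noteq> i}" using \<open>p i \<noteq> i\<close> \<open>i < ?n\<close> by blast
      \<comment> \<open>\<open>z\<close> is the vertex of a moved index \<open>k\<close> and has no
        \<open>r\<close>-successor at a moved index. Since \<open>p\<close> is injective,
        \<open>p k\<close> is moved as well, so the pair at \<open>(k, p k)\<close> is not in
        \<open>r\<close> and this off-diagonal entry vanishes.\<close>
      from wfE_min[OF wf this] obtain z where z: "z \<in> (!) vs ` {i. i < ?n \<and> p i \<noteq> i}"
        and max: "\<And>y. (y, z) \<in> r\<inverse> \<Longrightarrow> y \<notin> (!) vs ` {i. i < ?n \<and> p i \<noteq> i}" by blast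
      from z obtain k where k: "k < ?n" "p k \<noteq> k" "z = vs ! k" by blast
      have "p k < ?n" using permutes_in_image[OF p, of k] k by simp
      moreover have "p (p k) \<noteq> p k" using k permutes_inj[OF p] by (meson injD)
      ultimately have "(vs ! k, vs ! p k) \<notin> r" using max[of "vs ! p k"] k by auto
      then have "A $$ (k, p k) = 0" using k \<open>p k < ?n\<close> by (simp add: A_def)
      then show ?thesis using k by (intro prod_zero) auto
    qed
    have diag: "A $$ (i, i) = 1" if "i < ?n" for i
      using that True by (auto simp: A_def acyclic_def)
    have "det A = (\<Sum>p | p permutes {0..<?n}. signof p * (\<Prod>i = 0..<?n. A $$ (i, p i)))"
      by (rule det_def'[OF A])
    also have "\<dots> = (\<Sum>p\<in>{id}. signof p * (\<Prod>i = 0..<?n. A $$ (i, p i)))"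
      using vanish by (intro sum.mono_neutral_right) (auto simp: permutes_id finite_permutations)
    also have "\<dots> = 1" using diag by simp
    finally show ?thesis using True by simp
  next
    case False
    \<comment> \<open>\<open>u\<close> marks the vertices from which a cycle can be reached. As
      \<open>r\<close> is single-valued, \<open>u\<close> is constant along \<open>r\<close>, and it
      is 0 where \<open>r\<close> has no successor; these two facts say that every row of
      \<open>A\<close> annihilates \<open>u\<close>.\<close>
    define u where "u = (\<lambda>x. if \<exists>y. (x, y) \<in> r\<^sup>* \<and> (y, y) \<in> r\<^sup>+ then 1 else 0 :: int)"
    have u_step: "u x = u y" if "(x, y) \<in> r" for x y
    proof -
      have "\<exists>z. (y, z) \<in> r\<^sup>* \<and> (z, z) \<in> r\<^sup>+" if xz: "(x, z) \<in> r\<^sup>*" "(z, z) \<in> r\<^sup>+" for z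
      proof -
        have "(x, z) \<in> r\<^sup>+" using xz by (meson rtrancl_trancl_trancl)
        then obtain y' where "(x, y') \<in> r" "(y', z) \<in> r\<^sup>*" by (meson tranclD)
        then show ?thesis using \<open>(x, y) \<in> r\<close> \<open>single_valued r\<close> xz(2)
          by (metis single_valuedD)
      qed
      then show ?thesis using that by (auto simp: u_def intro: converse_rtrancl_into_rtrancl)
    qed
    have u_end: "u x = 0" if "x \<notin> Domain r" for x
    proof -
      have "(x, z) \<notin> r\<^sup>+" for z using that by (meson DomainI tranclD)
      then show ?thesis by (auto simp: u_def rtrancl_eq_or_trancl)
    qed
    let ?u = "vec ?n (\<lambda>i. u (vs ! i))"
    have "A *\<^sub>v ?u = 0\<^sub>v ?n"
    proof (intro eq_vecI)
      fix i assume "i < dim_vec (0\<^sub>v ?n :: int vec)"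
      then have i: "i < ?n" by simp
      have "(A *\<^sub>v ?u) $ i = (\<Sum>j = 0..<?n. A $$ (i, j) * u (vs ! j))"
        using i A by (simp add: scalar_prod_def)
      also have "\<dots> = (\<Sum>j = 0..<?n. (if j = i then u (vs ! i) else 0)
                          - (if (vs ! i, vs ! j) \<in> r then u (vs ! j) else 0))"
        using i by (intro sum.cong) (auto simp: A_def)
      also have "\<dots> = u (vs ! i) - (\<Sum>j = 0..<?n. if (vs ! i, vs ! j) \<in> r then u (vs ! j) else 0)"
        using i by (simp add: sum_subtractf)
      also have "(\<Sum>j = 0..<?n. if (vs ! i, vs ! j) \<in> r then u (vs ! j) else 0) = u (vs ! i)"
      proof (cases "vs ! i \<in> Domain r")
        case True
        then obtain w where w: "(vs ! i, w) \<in> r" by blast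
        then have "w \<in> set vs" using r_vs by blast
        then obtain k where k: "k < ?n" "w = vs ! k" by (auto simp: in_set_conv_nth)
        have "(vs ! i, vs ! j) \<in> r \<longleftrightarrow> j = k" if "j < ?n" for j
          using w k that \<open>single_valued r\<close> \<open>distinct vs\<close>
          by (metis nth_eq_iff_index_eq single_valuedD)
        then have "(\<Sum>j = 0..<?n. if (vs ! i, vs ! j) \<in> r then u (vs ! j) else 0)
            = (\<Sum>j = 0..<?n. if j = k then u (vs ! k) else 0)"
          by (intro sum.cong) auto
        then show ?thesis using k w u_step by simp
      next
        case False
        then show ?thesis by (auto simp: u_end intro!: sum.neutral)
      qed
      finally show "(A *\<^sub>v ?u) $ i = 0\<^sub>v ?n $ i" using i by simp
    qed (use A in simp)
    moreover have "?u \<noteq> 0\<^sub>v ?n"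
    proof -
      from False obtain x where x: "(x, x) \<in> r\<^sup>+" by (auto simp: acyclic_def)
      then have "u x = 1" by (auto simp: u_def)
      moreover have "x \<in> set vs" using x r_vs by (meson SigmaD1 subsetD tranclD)
      ultimately obtain i where "i < ?n" "u (vs ! i) = 1" by (auto simp: in_set_conv_nth)
      then show ?thesis by (metis index_vec index_zero_vec(1) zero_neq_one)
    qed
    ultimately have "det A = 0"
      using det_0_iff_vec_prod_zero[OF A] by (metis vec_carrier)
    then show ?thesis using False by simp
  qed
qed

section \<open>Rooted forests and the symbolic Laplacian at -1\<close>

text \<open>A loop chosen at \<open>v\<close> has \<open>ends G e = {v, v}\<close> and so yields the
  pair \<open>(v, v)\<close>; acyclicity therefore excludes loops as parent edges.\<close>

definition parent_rel :: "('v, 'e) multigraph \<Rightarrow> ('v \<Rightarrow> 'e option) \<Rightarrow> ('v \<times> 'v) set" where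
  "parent_rel G f = {(v, w) \<in> vertices G \<times> vertices G. \<exists>e. f v = Some e \<and> ends G e = {v, w}}"

text \<open>\<open>f v\<close> is the edge from \<open>v\<close> to its parent, \<open>None\<close> at a root.\<close>

definition rooted_forests :: "('v, 'e) multigraph \<Rightarrow> ('v \<Rightarrow> 'e option) set" where
  "rooted_forests G =
     {f \<in> PiE (vertices G) (\<lambda>v. insert None (Some ` {e \<in> edges G. v \<in> ends G e})).
        acyclic (parent_rel G f)}"

lemma single_valued_parent_rel: "single_valued (parent_rel G f)"
  by (auto simp: single_valued_def parent_rel_def doubleton_eq_iff)

lemma finite_rooted_forests:
  assumes "finite (vertices G)" and "finite (edges G)"
  shows "finite (rooted_forests G)"
proof (rule finite_subset)
  show "rooted_forests G \<subseteq> PiE (vertices G) (\<lambda>_. insert None (Some ` edges G))"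
    by (auto simp: rooted_forests_def PiE_iff extensional_def)
qed (use assms in \<open>auto intro!: finite_PiE\<close>)

text \<open>Taking \<open>t = -1\<close> adds 1 to each diagonal entry, and this 1 is the summand of
  a vertex without parent edge, that is, of a root. Multilinearity in the rows reduces the
  determinant to the integer determinants of \<open>det_one_minus_functional\<close>.\<close>

theorem p_symb_minus_one:
  assumes "distinct vs" and vs: "set vs = vertices G" and "finite (edges G)"
  shows "p_symb G x vs (- 1) =
    (\<Sum>f\<in>rooted_forests G. \<Prod>v\<in>vertices G. case f v of None \<Rightarrow> 1 | Some e \<Rightarrow> x e)"
proof -
  let ?n = "length vs" and ?V = "vertices G"
  define C where "C v = insert None (Some ` {e \<in> edges G. v \<in> ends G e})" for v
  define wt where "wt o' = (case o' of None \<Rightarrow> 1 | Some e \<Rightarrow> x e)" for o'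
  \<comment> \<open>Row \<open>v\<close> of \<open>L + 1\<close> is the sum over the possible parent edges of \<open>v\<close> of \<open>wt\<close> times \<open>row v\<close>.\<close>
  define row :: "'a \<Rightarrow> 'b option \<Rightarrow> 'a \<Rightarrow> int" where
    "row v o' w = (if v = w then 1 else 0) -
       (if \<exists>e. o' = Some e \<and> ends G e = {v, w} then 1 else 0)" for v o' w
  define L where "L = symb_laplacian G x vs - (- 1) \<cdot>\<^sub>m 1\<^sub>m ?n"
  have L: "L \<in> carrier_mat ?n ?n" unfolding L_def by (intro minus_carrier_mat) simp
  have fin_C: "finite (C v)" for v using assms by (simp add: C_def)
  have nth_eq: "vs ! i = vs ! j \<longleftrightarrow> i = j" if "i < ?n" "j < ?n" for i j
    using that assms(1) by (simp add: nth_eq_iff_index_eq)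
  have bij: "bij_betw ((!) vs) {0..<?n} ?V"
    using assms by (auto intro: bij_betw_nth simp: atLeast0LessThan)
  have entry: "L $$ (i, j) = (\<Sum>o'\<in>C (vs ! i). wt o' * of_int (row (vs ! i) o' (vs ! j)))"
    if "i < ?n" "j < ?n" for i j
  proof -
    let ?E = "{e \<in> edges G. vs ! i \<in> ends G e}"
    have "(\<Sum>o'\<in>C (vs ! i). wt o' * of_int (row (vs ! i) o' (vs ! j)))
        = (if i = j then 1 else 0) + (\<Sum>e\<in>?E. x e * of_int (row (vs ! i) (Some e) (vs ! j)))"
      using assms that
      by (simp add: C_def sum.reindex wt_def row_def nth_eq)
    \<comment> \<open>On the diagonal a loop gets the factor 1 - 1 = 0, in agreement with the
      omission of loops from the Laplacian.\<close>
    also have "(\<Sum>e\<in>?E. x e * of_int (row (vs ! i) (Some e) (vs ! j))) =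
       (if i = j then (\<Sum>e | e \<in> edges G \<and> vs ! i \<in> ends G e \<and> ends G e \<noteq> {vs ! i}. x e)
        else - (\<Sum>e | e \<in> edges G \<and> ends G e = {vs ! i, vs ! j}. x e))"
    proof (cases "i = j")
      case True
      then show ?thesis using assms by (simp add: row_def) (rule sum.mono_neutral_cong_right, auto)
    next
      case False
      then show ?thesis using assms that
        by (simp add: row_def nth_eq flip: sum_negf) (rule sum.mono_neutral_cong_right, auto)
    qed
    finally show ?thesis using that by (simp add: L_def symb_laplacian_def)
  qed
  define N :: "('a \<Rightarrow> 'b option) \<Rightarrow> int mat" where
    "N f = mat ?n ?n (\<lambda>(i, j). row (vs ! i) (f (vs ! i)) (vs ! j))" for f
  have det_N: "det (N f) = (if acyclic (parent_rel G f) then 1 else 0)" for f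
  proof -
    have "N f = mat ?n ?n (\<lambda>(i, j).
             (if i = j then 1 else 0) - (if (vs ! i, vs ! j) \<in> parent_rel G f then 1 else 0))"
      using vs by (intro eq_matI) (auto simp: N_def row_def parent_rel_def nth_eq simp flip: vs)
    moreover have "parent_rel G f \<subseteq> set vs \<times> set vs" using vs by (auto simp: parent_rel_def)
    ultimately show ?thesis
      using det_one_minus_functional[OF assms(1) single_valued_parent_rel] by (simp only:)
  qed
  have expand: "(\<Prod>i = 0..<?n. L $$ (i, p i)) =
      (\<Sum>f\<in>PiE ?V C. (\<Prod>v\<in>?V. wt (f v)) * of_int (\<Prod>i = 0..<?n. N f $$ (i, p i)))"
    if p: "p permutes {0..<?n}" for p
  proof -
    have p_less: "p i < ?n" if "i < ?n" for i using permutes_in_image[OF p, of i] that by simp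
    \<comment> \<open>\<open>q\<close> is \<open>p\<close> transported from positions to vertices.
      With factors indexed by vertices, the product of row sums distributes into a sum over the
      choice functions in \<open>PiE ?V C\<close>.\<close>
    define q where "q v = vs ! p (inv_into {0..<?n} ((!) vs) v)" for v
    have q: "q (vs ! i) = vs ! p i" if "i < ?n" for i
      using bij_betw_inv_into_left[OF bij] that by (simp add: q_def)
    have "(\<Prod>i = 0..<?n. L $$ (i, p i)) =
        (\<Prod>i = 0..<?n. \<Sum>o'\<in>C (vs ! i). wt o' * of_int (row (vs ! i) o' (q (vs ! i))))"
      by (intro prod.cong) (auto simp: entry p_less q)
    also have "\<dots> = (\<Prod>v\<in>?V. \<Sum>o'\<in>C v. wt o' * of_int (row v o' (q v)))"
      by (rule prod.reindex_bij_betw[OF bij])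
    also have "\<dots> = (\<Sum>f\<in>PiE ?V C. \<Prod>v\<in>?V. wt (f v) * of_int (row v (f v) (q v)))"
      using vs fin_C by (intro prod_sum_PiE) (auto simp flip: vs)
    also have "\<dots> = (\<Sum>f\<in>PiE ?V C. (\<Prod>v\<in>?V. wt (f v)) * of_int (\<Prod>i = 0..<?n. N f $$ (i, p i)))"
    proof (intro sum.cong refl)
      fix f
      have "(\<Prod>v\<in>?V. row v (f v) (q v)) = (\<Prod>i = 0..<?n. N f $$ (i, p i))"
        unfolding prod.reindex_bij_betw[OF bij, symmetric]
        by (intro prod.cong) (auto simp: N_def q p_less)
      then show "(\<Prod>v\<in>?V. wt (f v) * of_int (row v (f v) (q v))) =
          (\<Prod>v\<in>?V. wt (f v)) * of_int (\<Prod>i = 0..<?n. N f $$ (i, p i))"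
        by (simp add: prod.distrib flip: of_int_prod)
    qed
    finally show ?thesis .
  qed
  have "det L = (\<Sum>p | p permutes {0..<?n}. \<Sum>f\<in>PiE ?V C.
      (\<Prod>v\<in>?V. wt (f v)) * of_int (signof p * (\<Prod>i = 0..<?n. N f $$ (i, p i))))"
    unfolding det_def'[OF L]
    by (intro sum.cong refl) (simp add: expand sum_distrib_left sign_def mult_ac)
  \<comment> \<open>After the exchange, the inner sum over \<open>p\<close> is the Leibniz expansion
    of \<open>det (N f)\<close>.\<close>
  also have "\<dots> = (\<Sum>f\<in>PiE ?V C. \<Sum>p | p permutes {0..<?n}.
      (\<Prod>v\<in>?V. wt (f v)) * of_int (signof p * (\<Prod>i = 0..<?n. N f $$ (i, p i))))"
    by (rule sum.swap)
  also have "\<dots> = (\<Sum>f\<in>PiE ?V C. (\<Prod>v\<in>?V. wt (f v)) * of_int (det (N f)))"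
    by (intro sum.cong refl, subst det_def'[where n = ?n])
       (simp_all add: N_def sum_distrib_left)
  also have "\<dots> = (\<Sum>f\<in>rooted_forests G. \<Prod>v\<in>?V. wt (f v))"
    unfolding det_N using vs fin_C finite_set[of vs]
    by (intro sum.mono_neutral_cong_right)
       (auto simp: rooted_forests_def simp flip: C_def intro!: finite_PiE)
  finally show ?thesis by (simp add: p_symb_def L_def wt_def)
qed


section \<open>Acyclic matchings and pairs of forests\<close>

text \<open>A closed \<open>r\<close>-path is mapped to a closed \<open>S\<close>-path. The
  transitive closure in the hypothesis is needed because one pointer between regions corresponds to
  two arcs of the Tait graph.\<close>

lemma acyclic_if_trancl_hom:
  assumes "acyclic S" and "\<And>x y. (x, y) \<in> r \<Longrightarrow> (h x, h y) \<in> S\<^sup>+"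
  shows "acyclic r"
proof -
  have "(h x, h y) \<in> S\<^sup>+" if "(x, y) \<in> r\<^sup>+" for x y
    using that by induction (auto dest: assms(2) intro: trancl_trans)
  then show ?thesis using assms(1) by (auto simp: acyclic_def)
qed

text \<open>The rank is the number of strict predecessors: along a step from \<open>x\<close> to
  \<open>y\<close> all predecessors of \<open>x\<close> are kept, and \<open>x\<close> itself is a
  new one.\<close>

lemma acyclic_rank:
  assumes "finite r" and "acyclic r"
  obtains \<rho> :: "'a \<Rightarrow> nat" where "\<And>x y. (x, y) \<in> r \<Longrightarrow> \<rho> x < \<rho> y"
proof
  fix x y assume "(x, y) \<in> r"
  moreover have "finite {z. (z, y) \<in> r\<^sup>+}"
    by (rule finite_subset[of _ "Domain r"])
       (use assms(1) in \<open>auto simp: finite_Domain dest: tranclD\<close>)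
  ultimately show "card {z. (z, x) \<in> r\<^sup>+} < card {z. (z, y) \<in> r\<^sup>+}"
    using assms(2) by (intro psubset_card_mono) (auto simp: acyclic_def)
qed

text \<open>Every nonempty closed walk contains a cycle, so the absence of simple cycles can be
  tested on the arc relation alone.\<close>

lemma (in wf_digraph) no_cycle_iff_acyclic: "(\<nexists>p. cycle p) \<longleftrightarrow> acyclic (arcs_ends G)"
proof
  assume "\<nexists>p. cycle p"
  then show "acyclic (arcs_ends G)"
    unfolding acyclic_def reachable1_awalk
    using closed_w_imp_cycle by (auto simp: closed_w_def)
next
  assume "acyclic (arcs_ends G)"
  then show "\<nexists>p. cycle p"
    unfolding cycle_def acyclic_def by (blast intro: reachable1_awalkI)
qed

section \<open>Corners, their pointers and the forests they encode\<close>

text \<open>A dart stands for the corner to its left. In a chequerboard colouring the corners around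
  a crossing alternate in colour, so this is the other corner of the same colour.\<close>

definition opposite :: "'d projection \<Rightarrow> 'd \<Rightarrow> 'd" where
  "opposite D d = rot D (rot D d)"

text \<open>A selected corner makes its region point through the crossing to the region across it;
  this is the parent pointer in the forest.\<close>

definition corner_rel :: "'d projection \<Rightarrow> 'd set \<Rightarrow> ('d set \<times> 'd set) set" where
  "corner_rel D M = (\<lambda>d. (region D d, region D (opposite D d))) ` M"

text \<open>The black graph is \<open>colour_graph D (blacks D)\<close>, the white one \<open>colour_graph D (whites D)\<close>.\<close>

definition colour_graph :: "'d projection \<Rightarrow> 'd set set \<Rightarrow> ('d set, 'd set) multigraph" where
  "colour_graph D X = \<lparr>vertices = X, edges = crossings D, ends = (\<lambda>c. region D ` c \<inter> X)\<rparr>"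

definition forest_corners :: "'d projection \<Rightarrow> 'd set set \<Rightarrow> ('d set \<Rightarrow> 'd set option) \<Rightarrow> 'd set" where
  "forest_corners D X f = {d \<in> darts D. region D d \<in> X \<and> f (region D d) = Some (crossing D d)}"

text \<open>These are the acyclic matchings that use regions of one colour only. Injectivity of
  \<open>region D\<close> gives each region at most one parent edge, and injectivity of
  \<open>crossing D\<close> is the matching condition at the crossings.\<close>

definition acyclic_corner_sets :: "'d projection \<Rightarrow> 'd set set \<Rightarrow> 'd set set" where
  "acyclic_corner_sets D X = {M. M \<subseteq> darts D \<and> region D ` M \<subseteq> X \<and>
     inj_on (region D) M \<and> inj_on (crossing D) M \<and> acyclic (corner_rel D M)}"

section \<open>Crossings and colours\<close>

locale chequered_map =
  fixes D :: "'d projection"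
  assumes four_valent: "four_valent_map D" and chequered: "chequerboard D"
begin

lemma finite_darts: "finite (darts D)" and rot_permutes: "rot D permutes darts D"
  and flip_permutes: "flip D permutes darts D"
  using four_valent by (auto simp: four_valent_map_def)

lemma rot_in_darts: "d \<in> darts D \<Longrightarrow> rot D d \<in> darts D"
  by (simp add: permutes_in_image[OF rot_permutes])

lemma opposite_in_darts: "d \<in> darts D \<Longrightarrow> opposite D d \<in> darts D"
  by (simp add: opposite_def rot_in_darts)

lemma rot_permutation: "permutation (rot D)"
  using finite_darts rot_permutes by (auto simp: permutation_permutes)

lemma mem_crossing_self: "d \<in> crossing D d"
  unfolding crossing_def by (rule permutation_self_in_orbit[OF rot_permutation])

lemma crossing_rot: "crossing D (rot D d) = crossing D d"
  unfolding crossing_def by (rule permutation_orbit_step[OF rot_permutation])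

lemma crossing_opposite: "crossing D (opposite D d) = crossing D d"
  by (simp add: opposite_def crossing_rot)

lemma crossing_eq_if_mem: "e \<in> crossing D d \<Longrightarrow> crossing D e = crossing D d"
  unfolding crossing_def
  by (rule orbit_cyclic_eq3[OF cyclic_on_orbit[OF rot_permutes finite_darts]])

lemma crossing_subset: "d \<in> darts D \<Longrightarrow> crossing D d \<subseteq> darts D"
  unfolding crossing_def by (rule permutes_orbit_subset[OF rot_permutes])

text \<open>\<open>?k\<close> is the first return time of \<open>rot D\<close> at \<open>d\<close>,
  and the powers below it enumerate the orbit without repetition. Four-valence forces
  \<open>?k = 4\<close>, which yields all three claims.\<close>

lemma
  assumes "d \<in> darts D"
  shows crossing_eq: "crossing D d = {d, rot D d, opposite D d, rot D (opposite D d)}"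
    and opposite_opposite: "opposite D (opposite D d) = d"
    and opposite_neq: "opposite D d \<noteq> d"
proof -
  let ?k = "funpow_dist1 (rot D) d d"
  have self: "d \<in> orbit (rot D) d" using mem_crossing_self by (simp add: crossing_def)
  have orb: "crossing D d = (\<lambda>n. (rot D ^^ n) d) ` {0..<?k}"
    unfolding crossing_def by (rule orbit_conv_funpow_dist1[OF self])
  have inj: "inj_on (\<lambda>n. (rot D ^^ n) d) {0..<?k}"
    by (rule inj_on_funpow_dist1[OF self])
  have "card (crossing D d) = 4" using assms four_valent by (simp add: four_valent_map_def)
  then have k: "?k = 4" using card_image[OF inj] orb by simp
  have set4: "{0..<4} = {0, 1, 2, 3 :: nat}" by auto
  show "crossing D d = {d, rot D d, opposite D d, rot D (opposite D d)}"
    using orb unfolding k set4 by (simp add: opposite_def numeral_2_eq_2 numeral_3_eq_3)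
  show "opposite D (opposite D d) = d"
    using funpow_dist1_prop[OF self] unfolding k
    by (simp add: opposite_def numeral_eq_Suc)
  show "opposite D d \<noteq> d"
    using inj_onD[OF inj[unfolded k], of 2 0] by (auto simp: opposite_def numeral_2_eq_2)
qed

lemma region_in_regions: "d \<in> darts D \<Longrightarrow> region D d \<in> regions D"
  by (simp add: regions_def)

text \<open>The corners of \<open>d\<close> and \<open>rot D d\<close> are separated by the strand
  at \<open>rot D d\<close>. The far side of that strand is the region of
  \<open>flip D (rot D d)\<close>, whose successor along the boundary is \<open>d\<close>, so it is
  the region of \<open>d\<close>.\<close>

lemma region_rot_black_iff:
  assumes "d \<in> darts D"
  shows "region D (rot D d) \<in> blacks D \<longleftrightarrow> region D d \<notin> blacks D"
proof -
  let ?\<phi> = "inv_into UNIV (rot D) \<circ> flip D"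
  have "?\<phi> permutes darts D"
    by (intro permutes_compose permutes_inv rot_permutes flip_permutes)
  then have perm: "permutation ?\<phi>" using finite_darts by (auto simp: permutation_permutes)
  have "flip D (flip D (rot D d)) = rot D d"
    using four_valent rot_in_darts[OF assms] by (simp add: four_valent_map_def)
  then have "?\<phi> (flip D (rot D d)) = d"
    by (simp add: permutes_inj[OF rot_permutes])
  then have "region D (flip D (rot D d)) = region D d"
    using permutation_orbit_step[OF perm, of "flip D (rot D d)"] by (simp add: region_def)
  then show ?thesis
    using chequered rot_in_darts[OF assms] by (auto simp: chequerboard_def)
qed

section \<open>Forests of one colour as sets of corners\<close>

context
  fixes X assumes X: "X = blacks D \<or> X = whites D"
begin

lemma region_rot_iff: "d \<in> darts D \<Longrightarrow> region D (rot D d) \<in> X \<longleftrightarrow> region D d \<notin> X"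
  using X region_rot_black_iff[of d]
  by (auto simp: whites_def region_in_regions rot_in_darts)

lemma region_opposite_iff: "d \<in> darts D \<Longrightarrow> region D (opposite D d) \<in> X \<longleftrightarrow> region D d \<in> X"
  by (simp add: opposite_def region_rot_iff rot_in_darts)

text \<open>Colours alternate around the crossing, which excludes the two corners next to
  \<open>d\<close>. The regions may coincide; only the corners are compared.\<close>

lemma same_colour_corners:
  assumes "d \<in> darts D" "e \<in> darts D" "crossing D d = crossing D e"
    and "region D d \<in> X" "region D e \<in> X"
  shows "e = d \<or> e = opposite D d"
proof -
  have "e \<in> {d, rot D d, opposite D d, rot D (opposite D d)}"
    using mem_crossing_self[of e] assms crossing_eq[of d] by simp
  moreover have "e \<noteq> rot D d" "e \<noteq> rot D (opposite D d)"
    using assms region_rot_iff region_opposite_iff opposite_in_darts by metis+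
  ultimately show ?thesis by blast
qed

lemma ends_colour_graph:
  assumes "d \<in> darts D" "region D d \<in> X"
  shows "ends (colour_graph D X) (crossing D d) = {region D d, region D (opposite D d)}"
  using assms
  by (auto simp: colour_graph_def crossing_eq region_rot_iff region_opposite_iff opposite_in_darts)

lemma end_of_crossingE:
  assumes "c \<in> crossings D" "v \<in> ends (colour_graph D X) c"
  obtains d where "d \<in> darts D" "region D d = v" "crossing D d = c" "v \<in> X"
proof -
  from assms obtain d d' where "d' \<in> darts D" "c = crossing D d'" "d \<in> c" "v = region D d" "v \<in> X"
    by (auto simp: colour_graph_def crossings_def)
  then show ?thesis using that[of d] crossing_subset crossing_eq_if_mem by blast
qed

text \<open>An edge at \<open>v\<close> leaves through a corner of \<open>v\<close>, and its other
  end is the region of the opposite corner. For a loop both corners qualify and give the same pair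
  \<open>(v, v)\<close>.\<close>

lemma parent_rel_eq_corner_rel:
  assumes f: "f \<in> PiE X (\<lambda>v. insert None (Some ` {c \<in> crossings D. v \<in> ends (colour_graph D X) c}))"
  shows "parent_rel (colour_graph D X) f = corner_rel D (forest_corners D X f)"
proof (intro equalityI subrelI)
  fix v w assume "(v, w) \<in> parent_rel (colour_graph D X) f"
  then obtain c where c: "v \<in> X" "f v = Some c" "ends (colour_graph D X) c = {v, w}"
    by (auto simp: parent_rel_def colour_graph_def)
  then have "c \<in> crossings D" using f by (force simp: PiE_iff)
  then obtain d where d: "d \<in> darts D" "region D d = v" "crossing D d = c"
    using c by (metis end_of_crossingE insertI1)
  then have "{v, w} = {v, region D (opposite D d)}" using ends_colour_graph[of d] c by simp
  then have "w = region D (opposite D d)" by (auto simp: doubleton_eq_iff)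
  then show "(v, w) \<in> corner_rel D (forest_corners D X f)"
    using c d by (auto simp: corner_rel_def forest_corners_def)
next
  fix v w assume "(v, w) \<in> corner_rel D (forest_corners D X f)"
  then obtain d where d: "d \<in> darts D" "region D d \<in> X" "f (region D d) = Some (crossing D d)"
    and vw: "v = region D d" "w = region D (opposite D d)"
    by (auto simp: corner_rel_def forest_corners_def)
  then show "(v, w) \<in> parent_rel (colour_graph D X) f"
    using ends_colour_graph[of d] region_opposite_iff[of d]
    by (auto simp: parent_rel_def colour_graph_def)
qed

lemma rooted_forests_colour_graph:
  "rooted_forests (colour_graph D X) =
     {f \<in> PiE X (\<lambda>v. insert None (Some ` {c \<in> crossings D. v \<in> ends (colour_graph D X) c})).
        acyclic (corner_rel D (forest_corners D X f))}"
proof -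
  have "vertices (colour_graph D X) = X" "edges (colour_graph D X) = crossings D"
    by (simp_all add: colour_graph_def)
  then show ?thesis
    using parent_rel_eq_corner_rel by (auto simp: rooted_forests_def)
qed

lemma forest_cornersE:
  assumes "f \<in> rooted_forests (colour_graph D X)" and "v \<in> X" and "f v = Some c"
  obtains d where "d \<in> forest_corners D X f" "region D d = v" "crossing D d = c"
proof -
  have "c \<in> crossings D" "v \<in> ends (colour_graph D X) c"
    using assms by (auto simp: rooted_forests_colour_graph PiE_iff)
  then obtain d where "d \<in> darts D" "region D d = v" "crossing D d = c"
    by (rule end_of_crossingE)
  then show ?thesis using that assms by (auto simp: forest_corners_def)
qed

text \<open>Two distinct chosen corners at one crossing would be opposite, so their regions would
  point to each other, against acyclicity. Hence a crossing is used once; a region is used once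
  because \<open>f\<close> picks a single crossing for it.\<close>

lemma forest_corners_in_acyclic_corner_sets:
  assumes f: "f \<in> rooted_forests (colour_graph D X)"
  shows "forest_corners D X f \<in> acyclic_corner_sets D X"
proof -
  let ?M = "forest_corners D X f"
  have acyc: "acyclic (corner_rel D ?M)" using f by (simp add: rooted_forests_colour_graph)
  have inj: "inj_on (crossing D) ?M"
  proof (rule inj_onI, rule ccontr)
    fix d e assume de: "d \<in> ?M" "e \<in> ?M" "crossing D d = crossing D e" "d \<noteq> e"
    then have "e = opposite D d" using same_colour_corners[of d e] by (auto simp: forest_corners_def)
    moreover have "opposite D e = d"
      using \<open>e = opposite D d\<close> de opposite_opposite by (simp add: forest_corners_def)
    ultimately have "(region D d, region D e) \<in> corner_rel D ?M"
      "(region D e, region D d) \<in> corner_rel D ?M"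
      using de by (auto simp: corner_rel_def intro: rev_image_eqI)
    then show False using acyc by (meson acyclic_def r_into_trancl trancl_into_trancl)
  qed
  moreover have "inj_on (region D) ?M"
  proof (rule inj_onI)
    fix d e assume de: "d \<in> ?M" "e \<in> ?M" "region D d = region D e"
    then have "crossing D d = crossing D e" by (auto simp: forest_corners_def)
    then show "d = e" using inj de by (simp add: inj_on_def)
  qed
  ultimately show ?thesis using acyc by (auto simp: acyclic_corner_sets_def forest_corners_def)
qed

lemma inj_on_forest_corners: "inj_on (forest_corners D X) (rooted_forests (colour_graph D X))"
proof (rule inj_onI)
  fix f g assume f: "f \<in> rooted_forests (colour_graph D X)"
    and g: "g \<in> rooted_forests (colour_graph D X)"
    and eq: "forest_corners D X f = forest_corners D X g"
  have "f v = Some c \<longleftrightarrow> g v = Some c" if v: "v \<in> X" for v c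
  proof
    assume "f v = Some c"
    then obtain d where "d \<in> forest_corners D X g" "region D d = v" "crossing D d = c"
      using forest_cornersE[OF f v] eq by metis
    then show "g v = Some c" by (auto simp: forest_corners_def)
  next
    assume "g v = Some c"
    then obtain d where "d \<in> forest_corners D X f" "region D d = v" "crossing D d = c"
      using forest_cornersE[OF g v] eq by metis
    then show "f v = Some c" by (auto simp: forest_corners_def)
  qed
  then have "f v = g v" if "v \<in> X" for v using that by (metis option.exhaust)
  then show "f = g"
    using f g by (auto simp: rooted_forests_colour_graph intro: PiE_ext)
qed

text \<open>The preimage sends a region to the crossing of its unique corner in \<open>M\<close> and
  makes all other regions roots.\<close>

lemma acyclic_corner_set_in_image:
  assumes M: "M \<in> acyclic_corner_sets D X"
  shows "M \<in> forest_corners D X ` rooted_forests (colour_graph D X)"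
proof -
  have M': "M \<subseteq> darts D" "region D ` M \<subseteq> X" "inj_on (region D) M" "acyclic (corner_rel D M)"
    using M by (auto simp: acyclic_corner_sets_def)
  define f where "f = (\<lambda>v\<in>X. if v \<in> region D ` M
     then Some (crossing D (inv_into M (region D) v)) else None)"
  have f_region: "f (region D d) = Some (crossing D d)" if "d \<in> M" for d
    using that M' by (auto simp: f_def)
  have corners: "forest_corners D X f = M"
  proof (intro equalityI subsetI)
    fix d assume "d \<in> forest_corners D X f"
    then have d: "d \<in> darts D" "region D d \<in> X" "f (region D d) = Some (crossing D d)"
      by (auto simp: forest_corners_def)
    then obtain e where e: "e \<in> M" "region D e = region D d"
      by (auto simp: f_def split: if_splits)
    then have "crossing D e = crossing D d" using d f_region[of e] by simp
    then have "d = e \<or> d = opposite D e" using same_colour_corners[of e d] d e M' by auto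
    \<comment> \<open>A crossing alone does not tell which of two opposite corners of one region was
      selected. Such a crossing is a loop, which acyclicity rules out, so the corner is
      determined.\<close>
    moreover have "region D (opposite D e) \<noteq> region D e"
    proof
      assume "region D (opposite D e) = region D e"
      then have "(region D e, region D e) \<in> corner_rel D M"
        using e by (auto simp: corner_rel_def intro: rev_image_eqI)
      then show False using M' by (auto simp: acyclic_def)
    qed
    ultimately show "d \<in> M" using e by auto
  next
    fix d assume "d \<in> M"
    then show "d \<in> forest_corners D X f" using M' f_region by (auto simp: forest_corners_def)
  qed
  have "f v \<in> insert None (Some ` {c \<in> crossings D. v \<in> ends (colour_graph D X) c})" if "v \<in> X" for v
  proof (cases "v \<in> region D ` M")
    case True
    then obtain d where d: "d \<in> M" "v = region D d" by blast
    then have "v \<in> ends (colour_graph D X) (crossing D d)" using M' that ends_colour_graph[of d] by auto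
    moreover have "crossing D d \<in> crossings D" using d M' by (auto simp: crossings_def)
    ultimately show ?thesis using d f_region by simp
  qed (use that in \<open>simp add: f_def\<close>)
  then have "f \<in> rooted_forests (colour_graph D X)"
    using corners M' by (auto simp: rooted_forests_colour_graph f_def)
  then show ?thesis using corners by blast
qed

lemma bij_betw_forest_corners:
  "bij_betw (forest_corners D X) (rooted_forests (colour_graph D X)) (acyclic_corner_sets D X)"
  unfolding bij_betw_def
  using inj_on_forest_corners forest_corners_in_acyclic_corner_sets acyclic_corner_set_in_image
  by blast

end

section \<open>Acyclic matchings of the overlaid Tait graph\<close>

lemma whites_iff: "d \<in> darts D \<Longrightarrow> region D d \<in> whites D \<longleftrightarrow> region D d \<notin> blacks D"
  by (simp add: whites_def region_in_regions)

lemma matching_tait_graph_iff: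
  "matching (tait_graph D) M \<longleftrightarrow>
     M \<subseteq> darts D \<and> inj_on (region D) M \<and> inj_on (crossing D) M"
proof -
  have "{tail (tait_graph D) a, head (tait_graph D) a} = {Region (region D a), Crossing (crossing D a)}" for a
    by (auto simp: tait_graph_def)
  moreover have "arcs (tait_graph D) = darts D" by (simp add: tait_graph_def)
  ultimately show ?thesis unfolding matching_def inj_on_def by auto
qed

lemma wf_digraph_reverse_arcs: "wf_digraph (reverse_arcs M (tait_graph D))"
  by unfold_locales (auto simp: reverse_arcs_def tait_graph_def crossings_def region_in_regions)

lemma arcs_ends_reverse_arcs:
  "arcs_ends (reverse_arcs M (tait_graph D)) =
     (\<lambda>d. if (d \<in> M) = (region D d \<in> blacks D)
          then (Region (region D d), Crossing (crossing D d))
          else (Crossing (crossing D d), Region (region D d))) ` darts D"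
  by (auto simp: arcs_ends_conv reverse_arcs_def tait_graph_def intro!: image_cong)

text \<open>A matched arc together with the unmatched arc at the opposite corner is a path of two
  arcs between regions of one colour. It follows the pointer for black regions and runs against it
  for white ones. Conversely, acyclic pointers give a potential that falls along every arc.\<close>

lemma acyclic_reverse_arcs_iff:
  assumes M: "M \<subseteq> darts D" and inj: "inj_on (crossing D) M"
  shows "acyclic (arcs_ends (reverse_arcs M (tait_graph D))) \<longleftrightarrow>
     acyclic (corner_rel D {d \<in> M. region D d \<in> whites D}) \<and>
     acyclic (corner_rel D {d \<in> M. region D d \<in> blacks D})"
    (is "acyclic ?R \<longleftrightarrow> acyclic ?W \<and> acyclic ?B")
proof
  assume R: "acyclic ?R"
  \<comment> \<open>A crossing has at most one matched corner, so the arc at the opposite corner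
    keeps its direction.\<close>
  have opp: "opposite D d \<in> darts D" "opposite D d \<notin> M" if "d \<in> M" for d
  proof -
    show "opposite D d \<in> darts D" using that M opposite_in_darts by blast
    show "opposite D d \<notin> M"
    proof
      assume "opposite D d \<in> M"
      from inj_onD[OF inj crossing_opposite this that] show False
        using opposite_neq[of d] that M by auto
    qed
  qed
  have arc: "(if (d \<in> M) = (region D d \<in> blacks D)
          then (Region (region D d), Crossing (crossing D d))
          else (Crossing (crossing D d), Region (region D d))) \<in> ?R" if "d \<in> darts D" for d
    using that unfolding arcs_ends_reverse_arcs by blast
  have "acyclic ?B"
  proof (rule acyclic_if_trancl_hom[OF R])
    fix v w assume "(v, w) \<in> ?B"
    then obtain d where d: "d \<in> M" "region D d \<in> blacks D" "v = region D d" "w = region D (opposite D d)"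
      by (auto simp: corner_rel_def)
    then have "(Region v, Crossing (crossing D d)) \<in> ?R" using arc[of d] M by auto
    moreover have "(Crossing (crossing D d), Region w) \<in> ?R"
      using arc[of "opposite D d"] opp[of d] d M region_opposite_iff[of "blacks D" d]
      by (auto simp: crossing_opposite)
    ultimately show "(Region v, Region w) \<in> ?R\<^sup>+" by auto
  qed
  \<comment> \<open>The arcs traverse white pointers backwards, so it is the converse that embeds
    into \<open>?R\<close>.\<close>
  moreover have "acyclic (?W\<inverse>)"
  proof (rule acyclic_if_trancl_hom[OF R])
    fix w v assume "(w, v) \<in> ?W\<inverse>"
    then obtain d where d: "d \<in> M" "region D d \<in> whites D" "v = region D d" "w = region D (opposite D d)"
      by (auto simp: corner_rel_def)
    then have "(Crossing (crossing D d), Region v) \<in> ?R"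
      using arc[of d] M whites_iff[of d] by auto
    moreover have "(Region w, Crossing (crossing D d)) \<in> ?R"
      using arc[of "opposite D d"] opp[of d] d M region_opposite_iff[of "whites D" d]
        whites_iff[of "opposite D d"]
      by (auto simp: crossing_opposite)
    ultimately show "(Region w, Region v) \<in> ?R\<^sup>+" by auto
  qed
  ultimately show "acyclic ?W \<and> acyclic ?B" by (simp add: acyclic_converse)
next
  assume acyc: "acyclic ?W \<and> acyclic ?B"
  have fin: "finite ?W" "finite ?B"
    using finite_subset[OF M finite_darts] by (auto simp: corner_rel_def)
  obtain \<rho> :: "'d set \<Rightarrow> nat" where \<rho>: "\<And>v w. (v, w) \<in> ?W \<Longrightarrow> \<rho> v < \<rho> w"
    using acyclic_rank[OF fin(1)] acyc by blast
  \<comment> \<open>Black pointers are followed forwards and white ones backwards, yet the potential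
    must fall along both; hence \<sigma> ranks the converse of \<open>?B\<close> while \<rho> ranks
    \<open>?W\<close> itself.\<close>
  have "finite (?B\<inverse>)" "acyclic (?B\<inverse>)" using fin(2) acyc by (simp_all add: acyclic_converse)
  then obtain \<sigma> :: "'d set \<Rightarrow> nat" where "\<And>w v. (w, v) \<in> ?B\<inverse> \<Longrightarrow> \<sigma> w < \<sigma> v"
    using acyclic_rank by blast
  then have \<sigma>: "\<sigma> w < \<sigma> v" if "(v, w) \<in> ?B" for v w using that by blast
  \<comment> \<open>Every arc of \<open>?R\<close> decreases \<open>\<mu>\<close> lexicographically: the first component keeps white regions
    above black ones, the second one interleaves each matched crossing with its region.\<close>
  define \<mu> :: "'d cell \<Rightarrow> nat \<times> nat" where "\<mu> x = (case x of
      Region v \<Rightarrow> if v \<in> blacks D then (0, 2 * \<sigma> v + 1) else (2, 2 * \<rho> v)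
    | Crossing c \<Rightarrow> if c \<in> crossing D ` M
        then (let v = region D (inv_into M (crossing D) c)
              in if v \<in> blacks D then (0, 2 * \<sigma> v) else (2, 2 * \<rho> v + 1))
        else (1, 0))" for x
  have \<mu>_matched: "\<mu> (Crossing (crossing D d)) =
      (if region D d \<in> blacks D then (0, 2 * \<sigma> (region D d)) else (2, 2 * \<rho> (region D d) + 1))"
    if "d \<in> M" for d using that inj by (simp add: \<mu>_def)
  have \<mu>_unmatched: "\<mu> (Crossing c) = (1, 0)" if "c \<notin> crossing D ` M" for c
    using that by (simp add: \<mu>_def)
  have \<mu>_region: "\<mu> (Region v) = (if v \<in> blacks D then (0, 2 * \<sigma> v + 1) else (2, 2 * \<rho> v))" for v
    by (simp add: \<mu>_def)
  have step: "(\<mu> y, \<mu> x) \<in> less_than <*lex*> less_than" if "(x, y) \<in> ?R" for x y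
  proof -
    from that obtain d where d: "d \<in> darts D" and
      xy: "(x, y) = (if (d \<in> M) = (region D d \<in> blacks D)
          then (Region (region D d), Crossing (crossing D d))
          else (Crossing (crossing D d), Region (region D d)))"
      unfolding arcs_ends_reverse_arcs by blast
    consider "d \<in> M" | "crossing D d \<notin> crossing D ` M"
      | e where "e \<in> M" "crossing D e = crossing D d" "d \<notin> M" by (metis imageE)
    then show ?thesis
    proof cases
      case 1
      then show ?thesis using xy by (auto simp: \<mu>_matched \<mu>_region split: if_splits)
    next
      case 2
      then show ?thesis using xy by (auto simp: \<mu>_unmatched \<mu>_region split: if_splits)
    next
      \<comment> \<open>The crossing is matched at another corner \<open>e\<close>. If the colours
        agree, \<open>d\<close> is opposite to \<open>e\<close> and the ranks decide; otherwise the
        first component of \<mu> decides.\<close>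
      case (3 e)
      have same: "d = opposite D e" if "region D d \<in> X" "region D e \<in> X" "X = blacks D \<or> X = whites D" for X
        using same_colour_corners[of X e d] 3 d M that by auto
      have "\<sigma> (region D d) < \<sigma> (region D e)" if "region D d \<in> blacks D" "region D e \<in> blacks D"
        using that same 3 by (intro \<sigma>) (auto simp: corner_rel_def)
      moreover have "\<rho> (region D e) < \<rho> (region D d)" if "region D d \<in> whites D" "region D e \<in> whites D"
        using that same 3 by (intro \<rho>) (auto simp: corner_rel_def)
      ultimately show ?thesis
        using xy 3 d M whites_iff[of d] whites_iff[of e] \<mu>_matched[of e]
        by (auto simp: \<mu>_region split: if_splits)
    qed
  qed
  have "?R\<inverse> \<subseteq> inv_image (less_than <*lex*> less_than) \<mu>"
    unfolding inv_image_def using step by (simp only: subset_iff) blast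
  then have "wf (?R\<inverse>)"
    by (rule wf_subset[rotated]) (intro wf_inv_image wf_lex_prod wf_less_than)
  then show "acyclic ?R" using wf_acyclic[of "?R\<inverse>"] by (simp only: acyclic_converse)
qed

lemma discrete_morse_functions_iff:
  "M \<in> discrete_morse_functions D \<longleftrightarrow> M \<subseteq> darts D \<and> inj_on (region D) M \<and> inj_on (crossing D) M \<and>
     acyclic (corner_rel D {d \<in> M. region D d \<in> whites D}) \<and>
     acyclic (corner_rel D {d \<in> M. region D d \<in> blacks D})"
  unfolding discrete_morse_functions_def acyclic_matching_def matching_tait_graph_iff
    wf_digraph.no_cycle_iff_acyclic[OF wf_digraph_reverse_arcs]
  using acyclic_reverse_arcs_iff by auto

text \<open>A matching splits by colour. White and black parts never share a region, so the
  crossings are the only place where they can conflict.\<close>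

lemma bij_betw_discrete_morse_functions:
  "bij_betw (\<lambda>(A, B). A \<union> B)
     {(A, B) \<in> acyclic_corner_sets D (whites D) \<times> acyclic_corner_sets D (blacks D).
        crossing D ` A \<inter> crossing D ` B = {}}
     (discrete_morse_functions D)"
proof (rule bij_betw_byWitness[where
      f' = "\<lambda>M. ({d \<in> M. region D d \<in> whites D}, {d \<in> M. region D d \<in> blacks D})"])
  have disj: "whites D \<inter> blacks D = {}" by (auto simp: whites_def)
  have split: "{d \<in> A \<union> B. region D d \<in> whites D} = A" "{d \<in> A \<union> B. region D d \<in> blacks D} = B"
    if "A \<in> acyclic_corner_sets D (whites D)" "B \<in> acyclic_corner_sets D (blacks D)" for A B
    using that disj by (auto simp: acyclic_corner_sets_def)
  then show "\<forall>p\<in>{(A, B) \<in> acyclic_corner_sets D (whites D) \<times> acyclic_corner_sets D (blacks D).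
        crossing D ` A \<inter> crossing D ` B = {}}.
      (\<lambda>M. ({d \<in> M. region D d \<in> whites D}, {d \<in> M. region D d \<in> blacks D})) ((\<lambda>(A, B). A \<union> B) p) = p"
    by auto
  show "\<forall>M\<in>discrete_morse_functions D.
      (\<lambda>(A, B). A \<union> B) ({d \<in> M. region D d \<in> whites D}, {d \<in> M. region D d \<in> blacks D}) = M"
    by (auto simp: discrete_morse_functions_iff subset_iff whites_iff)
  show "(\<lambda>(A, B). A \<union> B) ` {(A, B) \<in> acyclic_corner_sets D (whites D) \<times> acyclic_corner_sets D (blacks D).
        crossing D ` A \<inter> crossing D ` B = {}} \<subseteq> discrete_morse_functions D"
  proof clarify
    fix A B assume A: "A \<in> acyclic_corner_sets D (whites D)" and B: "B \<in> acyclic_corner_sets D (blacks D)"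
      and AB: "crossing D ` A \<inter> crossing D ` B = {}"
    have "region D ` A \<inter> region D ` B = {}"
      using A B disj by (fastforce simp: acyclic_corner_sets_def)
    then show "A \<union> B \<in> discrete_morse_functions D"
      unfolding discrete_morse_functions_iff split[OF A B]
      using A B AB by (auto simp: acyclic_corner_sets_def inj_on_Un)
  qed
  show "(\<lambda>M. ({d \<in> M. region D d \<in> whites D}, {d \<in> M. region D d \<in> blacks D})) ` discrete_morse_functions D
    \<subseteq> {(A, B) \<in> acyclic_corner_sets D (whites D) \<times> acyclic_corner_sets D (blacks D).
        crossing D ` A \<inter> crossing D ` B = {}}"
  proof (intro image_subsetI)
    fix M assume M: "M \<in> discrete_morse_functions D"
    let ?W = "{d \<in> M. region D d \<in> whites D}" and ?B = "{d \<in> M. region D d \<in> blacks D}"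
    have "?W \<in> acyclic_corner_sets D (whites D)" "?B \<in> acyclic_corner_sets D (blacks D)"
      using M by (auto simp: discrete_morse_functions_iff acyclic_corner_sets_def intro: inj_on_subset)
    moreover have "crossing D ` ?W \<inter> crossing D ` ?B = crossing D ` (?W \<inter> ?B)"
      using M by (intro inj_on_image_Int[symmetric, of _ M]) (auto simp: discrete_morse_functions_iff)
    moreover have "?W \<inter> ?B = {}" using disj by blast
    ultimately show "(?W, ?B) \<in> {(A, B) \<in> acyclic_corner_sets D (whites D) \<times> acyclic_corner_sets D (blacks D).
        crossing D ` A \<inter> crossing D ` B = {}}" by simp
  qed
qed

text \<open>The edges used by a forest are the crossings of its corners, so the product of the two
  forest bijections carries edge-disjoint pairs of forests to compatible pairs of corner
  sets.\<close>

lemma card_discrete_morse_functions: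
  "card (discrete_morse_functions D) =
     card {(f, g) \<in> rooted_forests (white_graph D) \<times> rooted_forests (black_graph D).
       \<nexists>c. (\<exists>v\<in>whites D. f v = Some c) \<and> (\<exists>v\<in>blacks D. g v = Some c)}"
    (is "_ = card ?F")
proof -
  have graphs: "white_graph D = colour_graph D (whites D)" "black_graph D = colour_graph D (blacks D)"
    by (simp_all add: white_graph_def black_graph_def colour_graph_def)
  let ?P = "{(A, B) \<in> acyclic_corner_sets D (whites D) \<times> acyclic_corner_sets D (blacks D).
        crossing D ` A \<inter> crossing D ` B = {}}"
  let ?h = "map_prod (forest_corners D (whites D)) (forest_corners D (blacks D))"
  have used: "(\<exists>v\<in>X. f v = Some c) \<longleftrightarrow> c \<in> crossing D ` forest_corners D X f"
    if "f \<in> rooted_forests (colour_graph D X)" "X = blacks D \<or> X = whites D" for f X c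
  proof
    assume "\<exists>v\<in>X. f v = Some c"
    then show "c \<in> crossing D ` forest_corners D X f" using forest_cornersE[OF that(2,1)] by blast
  qed (auto simp: forest_corners_def)
  have disj_iff: "(\<nexists>c. (\<exists>v\<in>whites D. f v = Some c) \<and> (\<exists>v\<in>blacks D. g v = Some c)) \<longleftrightarrow>
      crossing D ` forest_corners D (whites D) f \<inter> crossing D ` forest_corners D (blacks D) g = {}"
    if "f \<in> rooted_forests (white_graph D)" "g \<in> rooted_forests (black_graph D)" for f g
    unfolding used[OF that(1)[unfolded graphs] disjI2[OF refl]]
      used[OF that(2)[unfolded graphs] disjI1[OF refl]] by blast
  have bij: "bij_betw ?h (rooted_forests (white_graph D) \<times> rooted_forests (black_graph D))
      (acyclic_corner_sets D (whites D) \<times> acyclic_corner_sets D (blacks D))"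
    unfolding graphs by (intro bij_betw_map_prod bij_betw_forest_corners) auto
  have F_iff: "(f, g) \<in> ?F \<longleftrightarrow> ?h (f, g) \<in> ?P"
    if "(f, g) \<in> rooted_forests (white_graph D) \<times> rooted_forests (black_graph D)" for f g
    using that bij_betwE[OF bij] disj_iff[of f g] by auto
  have "?h ` ?F = ?P"
  proof (intro equalityI subsetI)
    fix p assume "p \<in> ?h ` ?F"
    then obtain f g where fg: "(f, g) \<in> ?F" "p = ?h (f, g)" by (elim imageE) auto
    then have "(f, g) \<in> rooted_forests (white_graph D) \<times> rooted_forests (black_graph D)" by simp
    then show "p \<in> ?P" unfolding fg(2) using fg(1) by (rule F_iff[THEN iffD1])
  next
    fix p assume p: "p \<in> ?P"
    then have "p \<in> ?h ` (rooted_forests (white_graph D) \<times> rooted_forests (black_graph D))"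
      unfolding bij_betw_imp_surj_on[OF bij] by auto
    then obtain f g where fg: "(f, g) \<in> rooted_forests (white_graph D) \<times> rooted_forests (black_graph D)"
      "p = ?h (f, g)" by (elim imageE) auto
    from p have "?h (f, g) \<in> ?P" unfolding fg(2) .
    with fg(1) have "(f, g) \<in> ?F" by (rule F_iff[THEN iffD2])
    then show "p \<in> ?h ` ?F" unfolding fg(2) by (rule imageI)
  qed
  moreover have "inj_on ?h ?F"
    using bij_betw_imp_inj_on[OF bij] by (rule inj_on_subset) auto
  ultimately have "card ?F = card ?P" using card_image[of ?h ?F] by (simp only:)
  then show ?thesis using bij_betw_same_card[OF bij_betw_discrete_morse_functions] by (simp only:)
qed

end


section \<open>The polynomial ring modulo dual pairs\<close>

lemma mpoly_ring_simps:
  "p \<in> carrier (mpoly_ring V) \<longleftrightarrow> (\<forall>m\<in>Poly_Mapping.keys p. Poly_Mapping.keys m \<subseteq> V)"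
  "p \<otimes>\<^bsub>mpoly_ring V\<^esub> q = p * q" "p \<oplus>\<^bsub>mpoly_ring V\<^esub> q = p + q"
  "\<one>\<^bsub>mpoly_ring V\<^esub> = 1" "\<zero>\<^bsub>mpoly_ring V\<^esub> = 0"
  by (simp_all add: mpoly_ring_def)

lemma mpoly_ring_closed:
  assumes "p \<in> carrier (mpoly_ring V)" "q \<in> carrier (mpoly_ring V)"
  shows "p + q \<in> carrier (mpoly_ring V)" "p * q \<in> carrier (mpoly_ring V)"
    "p - q \<in> carrier (mpoly_ring V)"
  using assms keys_add[of p q] keys_mult[of p q] keys_diff[of p q]
  by (auto simp: mpoly_ring_simps dest!: subsetD[OF keys_add] subsetD)

lemma mpoly_ring_uminus_closed:
  "p \<in> carrier (mpoly_ring V) \<Longrightarrow> - p \<in> carrier (mpoly_ring V)"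
  by (simp add: mpoly_ring_simps)

lemma cring_mpoly_ring: "cring (mpoly_ring V)"
proof (rule cringI)
  show "abelian_group (mpoly_ring V)"
  proof (rule abelian_groupI)
    fix p assume "p \<in> carrier (mpoly_ring V)"
    then show "\<exists>q\<in>carrier (mpoly_ring V). q \<oplus>\<^bsub>mpoly_ring V\<^esub> p = \<zero>\<^bsub>mpoly_ring V\<^esub>"
      by (intro bexI[of _ "- p"]) (simp_all add: mpoly_ring_simps(2-) mpoly_ring_uminus_closed)
  qed (simp_all add: mpoly_ring_simps(2-) mpoly_ring_closed add_ac, simp add: mpoly_ring_simps)
  show "comm_monoid (mpoly_ring V)"
    by (rule comm_monoidI)
      (simp_all add: mpoly_ring_simps(2-) mpoly_ring_closed mult_ac, simp add: mpoly_ring_simps)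
qed (simp add: mpoly_ring_simps(2-) algebra_simps)

lemma sum_singles_keys:
  "(\<Sum>m\<in>Poly_Mapping.keys p. Poly_Mapping.single m (Poly_Mapping.lookup p m)) = p"
  by (rule poly_mapping_eqI)
     (simp add: lookup_sum lookup_single when_def in_keys_iff)

section \<open>Minimal representatives and the ideal of dual pairs\<close>

definition pair_free :: "'d projection \<Rightarrow> ('d set edge_var \<Rightarrow>\<^sub>0 nat) \<Rightarrow> bool" where
  "pair_free D m \<longleftrightarrow>
     \<not> (\<exists>c\<in>crossings D. Edge c \<in> Poly_Mapping.keys m \<and> Dual_Edge c \<in> Poly_Mapping.keys m)"

lemma lookup_discard_dual_pairs:
  "Poly_Mapping.lookup (discard_dual_pairs D p) m = (if pair_free D m then Poly_Mapping.lookup p m else 0)"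
proof -
  have "finite {m \<in> Poly_Mapping.keys p. pair_free D m}" by simp
  then show ?thesis
    unfolding discard_dual_pairs_def pair_free_def[symmetric]
    by (simp add: lookup_sum lookup_single when_def in_keys_iff)
qed

lemma discard_dual_pairs_add:
  "discard_dual_pairs D (p + q) = discard_dual_pairs D p + discard_dual_pairs D q"
  by (rule poly_mapping_eqI) (simp add: lookup_discard_dual_pairs lookup_add)

lemma discard_dual_pairs_diff:
  "discard_dual_pairs D (p - q) = discard_dual_pairs D p - discard_dual_pairs D q"
  by (rule poly_mapping_eqI) (simp add: lookup_discard_dual_pairs lookup_minus)

lemma discard_dual_pairs_zero: "discard_dual_pairs D 0 = 0"
  by (simp add: discard_dual_pairs_def)

lemma discard_dual_pairs_idem:
  "discard_dual_pairs D (discard_dual_pairs D p) = discard_dual_pairs D p"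
  by (rule poly_mapping_eqI) (simp add: lookup_discard_dual_pairs)

lemma discard_dual_pairs_sum:
  "discard_dual_pairs D (sum p A) = (\<Sum>x\<in>A. discard_dual_pairs D (p x))"
  by (induction A rule: infinite_finite_induct)
     (simp_all add: discard_dual_pairs_zero discard_dual_pairs_add)

lemma discard_dual_pairs_single:
  "discard_dual_pairs D (Poly_Mapping.single m a) = (if pair_free D m then Poly_Mapping.single m a else 0)"
  by (rule poly_mapping_eqI) (simp add: lookup_discard_dual_pairs lookup_single when_def)

lemma discard_dual_pairs_eq_0_iff:
  "discard_dual_pairs D p = 0 \<longleftrightarrow> (\<forall>m\<in>Poly_Mapping.keys p. \<not> pair_free D m)"
proof
  assume "discard_dual_pairs D p = 0"
  then have "(if pair_free D m then Poly_Mapping.lookup p m else 0) = 0" for m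
    by (metis lookup_discard_dual_pairs lookup_zero)
  then show "\<forall>m\<in>Poly_Mapping.keys p. \<not> pair_free D m" by (metis in_keys_iff)
qed (auto intro!: poly_mapping_eqI simp: lookup_discard_dual_pairs in_keys_iff)

lemma discard_dual_pairs_closed:
  "p \<in> carrier (edge_ring D) \<Longrightarrow> discard_dual_pairs D p \<in> carrier (edge_ring D)"
  by (auto simp: edge_ring_def mpoly_ring_simps in_keys_iff lookup_discard_dual_pairs split: if_splits)

lemma not_pair_free_add: "\<not> pair_free D n \<Longrightarrow> \<not> pair_free D (m + n)"
  by (auto simp: pair_free_def in_keys_iff lookup_add)

lemma cring_edge_ring: "cring (edge_ring D)"
  by (simp add: edge_ring_def cring_mpoly_ring)

lemma ring_edge_ring: "ring (edge_ring D)"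
  using cring_edge_ring by (rule cring.axioms)

lemma edge_ring_simps:
  "p \<in> carrier (edge_ring D) \<longleftrightarrow>
     (\<forall>m\<in>Poly_Mapping.keys p. Poly_Mapping.keys m \<subseteq> Edge ` crossings D \<union> Dual_Edge ` crossings D)"
  "p \<otimes>\<^bsub>edge_ring D\<^esub> q = p * q" "p \<oplus>\<^bsub>edge_ring D\<^esub> q = p + q"
  "\<one>\<^bsub>edge_ring D\<^esub> = 1" "\<zero>\<^bsub>edge_ring D\<^esub> = 0"
  unfolding edge_ring_def by (rule mpoly_ring_simps)+

lemma edge_ring_closed:
  assumes "p \<in> carrier (edge_ring D)" "q \<in> carrier (edge_ring D)"
  shows "p + q \<in> carrier (edge_ring D)" "p * q \<in> carrier (edge_ring D)"
    "p - q \<in> carrier (edge_ring D)"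
  using assms unfolding edge_ring_def by (rule mpoly_ring_closed)+

lemma edge_ring_uminus_closed:
  "p \<in> carrier (edge_ring D) \<Longrightarrow> - p \<in> carrier (edge_ring D)"
  unfolding edge_ring_def by (rule mpoly_ring_uminus_closed)

lemma var_mult_var:
  "var x * var y = Poly_Mapping.single (Poly_Mapping.single x 1 + Poly_Mapping.single y 1) 1"
  by (simp add: var_def mult_single)

lemma dual_pairs_in_edge_ring:
  "(\<lambda>c. var (Edge c) * var (Dual_Edge c)) ` crossings D \<subseteq> carrier (edge_ring D)"
  by (auto simp: var_mult_var edge_ring_simps dest!: subsetD[OF keys_add])

lemma ideal_dual_pair_ideal: "ideal (dual_pair_ideal D) (edge_ring D)"
  unfolding dual_pair_ideal_def by (rule ring.genideal_ideal[OF ring_edge_ring dual_pairs_in_edge_ring])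

lemma a_inv_edge_ring:
  assumes "p \<in> carrier (edge_ring D)"
  shows "\<ominus>\<^bsub>edge_ring D\<^esub> p = - p"
proof -
  interpret cring "edge_ring D" by (rule cring_edge_ring)
  show ?thesis
    using minus_equality[of "- p" p] assms by (simp add: edge_ring_simps(2-) edge_ring_uminus_closed)
qed

text \<open>Multiplication only adds exponents, so a monomial that contains a dual pair keeps it in
  every multiple.\<close>

lemma ideal_discarded:
  "ideal {p \<in> carrier (edge_ring D). discard_dual_pairs D p = 0} (edge_ring D)" (is "ideal ?J _")
proof -
  interpret R: cring "edge_ring D" by (rule cring_edge_ring)
  have mult: "x * p \<in> ?J" if p: "p \<in> ?J" and x: "x \<in> carrier (edge_ring D)" for p x
  proof -
    have "\<forall>m\<in>Poly_Mapping.keys (x * p). \<not> pair_free D m"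
      using p keys_mult[of x p] not_pair_free_add by (fastforce simp: discard_dual_pairs_eq_0_iff)
    then show ?thesis using p x by (simp add: edge_ring_closed discard_dual_pairs_eq_0_iff)
  qed
  show ?thesis
  proof (rule idealI[OF R.ring_axioms])
    show "subgroup ?J (add_monoid (edge_ring D))"
    proof
      show "\<one>\<^bsub>add_monoid (edge_ring D)\<^esub> \<in> ?J"
        by (simp add: edge_ring_simps discard_dual_pairs_zero)
      fix p assume p: "p \<in> ?J"
      then have "discard_dual_pairs D (- p) = 0"
        by (simp add: discard_dual_pairs_eq_0_iff)
      then show "inv\<^bsub>add_monoid (edge_ring D)\<^esub> p \<in> ?J"
        using p unfolding a_inv_def[symmetric] by (simp add: a_inv_edge_ring edge_ring_uminus_closed)
    qed (auto simp: edge_ring_simps(2-) edge_ring_closed discard_dual_pairs_add)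
  next
    fix p x assume "p \<in> ?J" "x \<in> carrier (edge_ring D)"
    then show "x \<otimes>\<^bsub>edge_ring D\<^esub> p \<in> ?J" "p \<otimes>\<^bsub>edge_ring D\<^esub> x \<in> ?J"
      using mult unfolding edge_ring_simps(2) by (simp_all add: mult.commute)
  qed
qed

lemma single_in_dual_pair_ideal:
  assumes m: "\<not> pair_free D m" and keys: "Poly_Mapping.keys m \<subseteq> Edge ` crossings D \<union> Dual_Edge ` crossings D"
  shows "Poly_Mapping.single m a \<in> dual_pair_ideal D"
proof -
  from m obtain c where c: "c \<in> crossings D" "Edge c \<in> Poly_Mapping.keys m" "Dual_Edge c \<in> Poly_Mapping.keys m"
    by (auto simp: pair_free_def)
  define n where "n = Poly_Mapping.single (Edge c) (1::nat) + Poly_Mapping.single (Dual_Edge c) 1"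
  \<comment> \<open>Subtraction of exponents is truncated; nothing is lost because both variables
    occur in \<open>m\<close>.\<close>
  have split: "(m - n) + n = m"
    using c by (intro poly_mapping_eqI)
      (auto simp: n_def lookup_add lookup_minus lookup_single when_def in_keys_iff)
  have "Poly_Mapping.keys (m - n) \<subseteq> Poly_Mapping.keys m"
    by (auto simp: in_keys_iff lookup_minus)
  then have "Poly_Mapping.single (m - n) a \<in> carrier (edge_ring D)"
    using keys by (auto simp: edge_ring_simps)
  moreover have "var (Edge c) * var (Dual_Edge c) \<in> dual_pair_ideal D"
    unfolding dual_pair_ideal_def
    using ring.genideal_self[OF ring_edge_ring dual_pairs_in_edge_ring] c by blast
  ultimately have "Poly_Mapping.single (m - n) a * (var (Edge c) * var (Dual_Edge c)) \<in> dual_pair_ideal D"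
    using ideal.I_l_closed[OF ideal_dual_pair_ideal] unfolding edge_ring_simps(2) by blast
  moreover have "Poly_Mapping.single (m - n) a * (var (Edge c) * var (Dual_Edge c)) = Poly_Mapping.single m a"
    unfolding var_mult_var mult_single n_def[symmetric] split by simp
  ultimately show ?thesis by simp
qed

text \<open>The right-hand side is an ideal containing the generators, hence contains the generated
  ideal. Conversely, each of its elements is a sum of monomials that are multiples of a
  generator.\<close>

lemma dual_pair_ideal_eq:
  "dual_pair_ideal D = {p \<in> carrier (edge_ring D). discard_dual_pairs D p = 0}" (is "_ = ?J")
proof
  have "\<not> pair_free D (Poly_Mapping.single (Edge c) 1 + Poly_Mapping.single (Dual_Edge c) 1)"
    if "c \<in> crossings D" for c
    using that by (auto simp: pair_free_def in_keys_iff lookup_add lookup_single when_def)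
  then have "(\<lambda>c. var (Edge c) * var (Dual_Edge c)) ` crossings D \<subseteq> ?J"
    using dual_pairs_in_edge_ring by (auto simp: var_mult_var discard_dual_pairs_single)
  then show "dual_pair_ideal D \<subseteq> ?J"
    unfolding dual_pair_ideal_def by (rule ring.genideal_minimal[OF ring_edge_ring ideal_discarded])
next
  interpret I: ideal "dual_pair_ideal D" "edge_ring D" by (rule ideal_dual_pair_ideal)
  have sum: "sum h A \<in> dual_pair_ideal D" if "\<And>x. x \<in> A \<Longrightarrow> h x \<in> dual_pair_ideal D"
    for A :: "('a set edge_var \<Rightarrow>\<^sub>0 nat) set" and h
    using that
  proof (induction A rule: infinite_finite_induct)
    case (insert x A)
    then show ?case using additive_subgroup.a_closed[OF I.is_additive_subgroup, of "h x" "sum h A"] by (simp add: edge_ring_simps(3))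
  qed (use additive_subgroup.zero_closed[OF I.is_additive_subgroup]
      in \<open>simp_all add: edge_ring_simps(5)\<close>)
  show "?J \<subseteq> dual_pair_ideal D"
  proof
    fix p assume p: "p \<in> ?J"
    then have "\<forall>m\<in>Poly_Mapping.keys p. \<not> pair_free D m" by (simp add: discard_dual_pairs_eq_0_iff)
    then have "(\<Sum>m\<in>Poly_Mapping.keys p. Poly_Mapping.single m (Poly_Mapping.lookup p m)) \<in> dual_pair_ideal D"
      using p by (intro sum single_in_dual_pair_ideal) (auto simp: edge_ring_simps)
    then show "p \<in> dual_pair_ideal D" by (simp add: sum_singles_keys)
  qed
qed

text \<open>Discarding is additive with the ideal as its kernel, so cosets are its fibres and the
  minimal representative depends only on the class.\<close>

lemma mem_dual_pair_coset_iff: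
  assumes q: "q \<in> carrier (edge_ring D)"
  shows "p \<in> dual_pair_ideal D +>\<^bsub>edge_ring D\<^esub> q \<longleftrightarrow>
    p \<in> carrier (edge_ring D) \<and> discard_dual_pairs D p = discard_dual_pairs D q"
proof -
  have "p \<in> dual_pair_ideal D +>\<^bsub>edge_ring D\<^esub> q \<longleftrightarrow> (\<exists>h\<in>dual_pair_ideal D. p = h + q)"
    by (auto simp: a_r_coset_def r_coset_def edge_ring_simps)
  also have "\<dots> \<longleftrightarrow> p - q \<in> dual_pair_ideal D" by (auto simp: algebra_simps intro: bexI[of _ "p - q"])
  also have "\<dots> \<longleftrightarrow> p \<in> carrier (edge_ring D) \<and> discard_dual_pairs D p = discard_dual_pairs D q"
    using q edge_ring_closed(1)[of "p - q" D q] edge_ring_closed(3)[of p D q]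
    by (auto simp: dual_pair_ideal_eq discard_dual_pairs_diff)
  finally show ?thesis .
qed

text \<open>At 1 every monomial has value 1, so evaluation is the sum of the coefficients.\<close>

lemma eval_mpoly_one_add:
  "eval_mpoly (\<lambda>_. 1) (p + q) = eval_mpoly (\<lambda>_. 1) p + eval_mpoly (\<lambda>_. 1) q"
  unfolding eval_mpoly_def by simp (rule setsum_keys_plus_distrib, simp_all)

lemma eval_mpoly_one_sum:
  "eval_mpoly (\<lambda>_. 1) (sum p A) = (\<Sum>x\<in>A. eval_mpoly (\<lambda>_. 1) (p x))"
  by (induction A rule: infinite_finite_induct) (simp_all add: eval_mpoly_one_add, simp_all add: eval_mpoly_def)

lemma eval_mpoly_one_single: "eval_mpoly (\<lambda>_. 1) (Poly_Mapping.single m a) = a"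
  by (simp add: eval_mpoly_def)

section \<open>Forest monomials and the count\<close>

text \<open>Monomials are exponent maps, so a product of variables becomes a sum and roots
  contribute 0. \<open>K\<close> will be \<open>Edge\<close> or \<open>Dual_Edge\<close>.\<close>

definition forest_monomial :: "('e \<Rightarrow> 'x) \<Rightarrow> 'v set \<Rightarrow> ('v \<Rightarrow> 'e option) \<Rightarrow> 'x \<Rightarrow>\<^sub>0 nat" where
  "forest_monomial K V f = (\<Sum>v\<in>V. case f v of None \<Rightarrow> 0 | Some e \<Rightarrow> Poly_Mapping.single (K e) 1)"

lemma prod_var_eq_forest_monomial:
  "(\<Prod>v\<in>V. case f v of None \<Rightarrow> 1 | Some e \<Rightarrow> var (K e)) = Poly_Mapping.single (forest_monomial K V f) 1"
  by (induction V rule: infinite_finite_induct)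
     (auto simp: forest_monomial_def var_def mult_single split: option.split)

text \<open>Exponents are natural numbers, so nothing cancels and every chosen edge remains visible
  in the monomial.\<close>

lemma keys_forest_monomial:
  assumes "finite V"
  shows "Poly_Mapping.keys (forest_monomial K V f) = K ` {e. \<exists>v\<in>V. f v = Some e}"
proof -
  have "Poly_Mapping.lookup (case f v of None \<Rightarrow> 0 | Some e \<Rightarrow> Poly_Mapping.single (K e) 1) x \<noteq> (0::nat) \<longleftrightarrow>
      (\<exists>e. f v = Some e \<and> K e = x)" for v x
    by (cases "f v") (auto simp: lookup_single when_def)
  then have "x \<in> Poly_Mapping.keys (forest_monomial K V f) \<longleftrightarrow> (\<exists>v\<in>V. \<exists>e. f v = Some e \<and> K e = x)" for x
    using assms by (simp add: in_keys_iff forest_monomial_def lookup_sum)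
  then show ?thesis by (simp add: set_eq_iff image_iff) blast
qed

lemma keys_add_nat: "Poly_Mapping.keys (m + n) = Poly_Mapping.keys m \<union> Poly_Mapping.keys n"
  for m n :: "'x \<Rightarrow>\<^sub>0 nat"
  by (auto simp: in_keys_iff lookup_add)

theorem morse_product_eq:
  assumes "finite (crossings D)"
    and "distinct ws" and "set ws = vertices (white_graph D)"
    and "distinct bs" and "set bs = vertices (black_graph D)"
  shows "morse_product D ws bs =
    (\<Sum>(f, g)\<in>rooted_forests (white_graph D) \<times> rooted_forests (black_graph D).
       Poly_Mapping.single (forest_monomial Edge (whites D) f + forest_monomial Dual_Edge (blacks D) g) 1)"
proof -
  have "finite (edges (white_graph D))" "finite (edges (black_graph D))"
    using assms by (simp_all add: white_graph_def black_graph_def)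
  then show ?thesis
    using assms
    by (simp add: morse_product_def p_symb_minus_one prod_var_eq_forest_monomial sum_product
        sum.cartesian_product mult_single)
       (simp add: white_graph_def black_graph_def)
qed

theorem proposition5p2:
  fixes D :: "'d projection" and ws bs :: "'d set list"
  assumes "knot_projection D"
    and "distinct ws" and "set ws = vertices (white_graph D)"
    and "distinct bs" and "set bs = vertices (black_graph D)"
  shows "morse_product D ws bs \<in> carrier (edge_ring D) \<and>
    morse_class D ws bs \<in> carrier (edge_ring D Quot dual_pair_ideal D) \<and>
    (\<forall>p \<in> morse_class D ws bs.
       discard_dual_pairs D p \<in> morse_class D ws bs \<and>
       eval_mpoly (\<lambda>_. 1) (discard_dual_pairs D p) = int (card (discrete_morse_functions D)))"
proof -
  interpret chequered_map D
    using assms(1) by unfold_locales (simp_all add: knot_projection_def)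
  let ?q = "morse_product D ws bs"
  let ?F = "rooted_forests (white_graph D) \<times> rooted_forests (black_graph D)"
  define mon :: "('d set \<Rightarrow> 'd set option) \<times> ('d set \<Rightarrow> 'd set option) \<Rightarrow> 'd set edge_var \<Rightarrow>\<^sub>0 nat" where
    "mon = (\<lambda>(f, g). forest_monomial Edge (whites D) f + forest_monomial Dual_Edge (blacks D) g)"
  have fin: "finite (crossings D)" "finite (whites D)" "finite (blacks D)"
    using finite_darts List.finite_set[of ws] List.finite_set[of bs]
    unfolding assms(3,5) by (simp_all add: crossings_def white_graph_def black_graph_def)
  then have fin_F: "finite ?F"
    by (intro finite_cartesian_product finite_rooted_forests) (simp_all add: white_graph_def black_graph_def)
  have q_eq: "?q = (\<Sum>x\<in>?F. Poly_Mapping.single (mon x) 1)"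
    unfolding morse_product_eq[OF fin(1) assms(2-5)] by (simp add: mon_def case_prod_beta')
  have keys_m: "Poly_Mapping.keys (mon (f, g)) =
      Edge ` {c. \<exists>v\<in>whites D. f v = Some c} \<union> Dual_Edge ` {c. \<exists>v\<in>blacks D. g v = Some c}" for f g
    using fin by (simp add: mon_def keys_add_nat keys_forest_monomial)
  have used: "c \<in> crossings D"
    if "f \<in> rooted_forests G" "edges G = crossings D" "v \<in> vertices G" "f v = Some c" for f G v c
    using that by (force simp: rooted_forests_def PiE_iff)
  have keys_F: "Poly_Mapping.keys (mon x) \<subseteq> Edge ` crossings D \<union> Dual_Edge ` crossings D" if x: "x \<in> ?F" for x
  proof -
    obtain f g where fg: "x = (f, g)" by (cases x)
    have "{c. \<exists>v\<in>whites D. f v = Some c} \<subseteq> crossings D" "{c. \<exists>v\<in>blacks D. g v = Some c} \<subseteq> crossings D"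
      using x used[of f "white_graph D"] used[of g "black_graph D"]
      by (auto simp: fg white_graph_def black_graph_def)
    then show ?thesis unfolding fg keys_m by blast
  qed
  \<comment> \<open>Surviving the discarding means that no crossing serves both forests, which is
    the condition in \<open>card_discrete_morse_functions\<close>.\<close>
  have pair_free_m: "pair_free D (mon (f, g)) \<longleftrightarrow>
      (\<nexists>c. (\<exists>v\<in>whites D. f v = Some c) \<and> (\<exists>v\<in>blacks D. g v = Some c))" if "(f, g) \<in> ?F" for f g
  proof -
    have "Edge c \<in> Poly_Mapping.keys (mon (f, g)) \<longleftrightarrow> (\<exists>v\<in>whites D. f v = Some c)"
      "Dual_Edge c \<in> Poly_Mapping.keys (mon (f, g)) \<longleftrightarrow> (\<exists>v\<in>blacks D. g v = Some c)" for c
      unfolding keys_m by auto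
    then show ?thesis
      using keys_F[OF that] unfolding pair_free_def by blast
  qed
  have q: "?q \<in> carrier (edge_ring D)"
  proof -
    have "Poly_Mapping.keys ?q \<subseteq> (\<Union>x\<in>?F. Poly_Mapping.keys (Poly_Mapping.single (mon x) (1::int)))"
      unfolding q_eq by (rule keys_sum)
    then have "Poly_Mapping.keys ?q \<subseteq> mon ` ?F" by simp blast
    then show ?thesis using keys_F unfolding edge_ring_simps by blast
  qed
  have eval: "eval_mpoly (\<lambda>_. 1) (discard_dual_pairs D ?q) = int (card (discrete_morse_functions D))"
  proof -
    \<comment> \<open>Different pairs of forests may share a monomial, for instance when only the
      roots differ. Linearity counts each pair separately without computing coefficients.\<close>
    have "eval_mpoly (\<lambda>_. 1) (discard_dual_pairs D ?q) =
        (\<Sum>x\<in>?F. eval_mpoly (\<lambda>_. 1) (discard_dual_pairs D (Poly_Mapping.single (mon x) 1)))"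
      unfolding q_eq discard_dual_pairs_sum eval_mpoly_one_sum ..
    also have "\<dots> = (\<Sum>x\<in>?F. if pair_free D (mon x) then 1 else 0)"
      by (intro sum.cong refl)
         (simp add: discard_dual_pairs_single eval_mpoly_one_single, simp add: eval_mpoly_def)
    also have "\<dots> = int (card {x \<in> ?F. pair_free D (mon x)})"
      using fin_F by (simp add: sum.If_cases Int_def)
    also have "{x \<in> ?F. pair_free D (mon x)} = {(f, g) \<in> ?F.
        \<nexists>c. (\<exists>v\<in>whites D. f v = Some c) \<and> (\<exists>v\<in>blacks D. g v = Some c)}"
      using pair_free_m by auto
    finally show ?thesis unfolding card_discrete_morse_functions .
  qed
  have "morse_class D ws bs \<in> carrier (edge_ring D Quot dual_pair_ideal D)"
    using q by (auto simp: morse_class_def FactRing_def A_RCOSETS_def' )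
  \<comment> \<open>By the description of cosets as fibres, \<open>p\<close> and \<open>?q\<close>
    have the same minimal representative, so the value found for \<open>?q\<close> carries
    over.\<close>
  moreover have "discard_dual_pairs D p \<in> morse_class D ws bs \<and>
      eval_mpoly (\<lambda>_. 1) (discard_dual_pairs D p) = int (card (discrete_morse_functions D))"
    if "p \<in> morse_class D ws bs" for p
    using that eval unfolding morse_class_def mem_dual_pair_coset_iff[OF q]
    by (simp add: q discard_dual_pairs_closed discard_dual_pairs_idem)
  ultimately show ?thesis using q by blast
qed

end
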